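(* Consider the asset-allocation model of the context, with state spaces $X_k$, control spaces $\mathcal M_k=[0,\delta_k]\times[0,\delta_k]$, constraint functions $c_k$ and admissible control sets $$U_k(S,B)=\{(u,v)\in\mathcal M_k:\ c_k(u,v,S,B)\le0\},\qquad (S,B)\in X_k.$$ Then for every $k=0,\dots,N-1$ the set-valued map $(S,B)\mapsto U_k(S,B)$ is Lipschitz continuous over $X_k$ with respect to the Hausdorff metric $d_H$. Moreover, if $g:[0,+\infty)\times[0,+\infty)\to\mathbb R$ is Lipschitz continuous, then the value function $J_k$ defined by $$J_N=g\ \text{ on }X_N,\qquad J_k(S,B)=\sup_{(u,v)\in U_k(S,B)}\ \sum_{(y^s,y^b)\in\mathcal Y_k}p_k(y^s,y^b)\,J_{k+1}\big(f_k(S,B,u,v,y^s,y^b)\big),\quad (S,B)\in X_k,\ 0\le k<N,$$ is Lipschitz continuous over $X_k$ for every $k=0,\dots,N$.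
   Context: **Hausdorff metric.** For non-empty compact sets $K_1,K_2$: $d_H(K_1,K_2)=\inf\{\varepsilon>0: K_1\subset K_2^\varepsilon,\ K_2\subset K_1^\varepsilon\}$, where $K^\varepsilon=\{y:d(y,K)<\varepsilon\}$. **Model.** Fix transaction cost coefficients $\lambda^s,\lambda^b\in(0,1)$ and a level $\alpha\in(0,1)$. For each $0\le k\le N-1$, $(Y_k^s,Y_k^b)$ is a random vector with values in a finite set $\mathcal Y_k\subset(0,\infty)^2$ and probabilities $p_k(y^s,y^b)=P(Y^s_k=y^s,Y^b_k=y^b)$. The state $(S_k,B_k)$ (risky and riskless wealth) evolves by $(S_{k+1},B_{k+1})=f_k(S_k,B_k,u_k,v_k,Y_k^s,Y_k^b)$ with $$f_k(S,B,u,v,y^s,y^b)=\big([S(1-u)+Bv(1-\lambda^s)]y^s,\ [B(1-v)+Su(1-\lambda^b)]y^b\big).$$ Put $$q_k=\frac{1-\alpha}{\alpha}\min\Big(1,\min_{(y^s,y^b)\in\mathcal Y_k}\frac{y^b}{y^s}\Big),\qquad \delta_k=\frac{1}{q_k(1-\lambda^b)+1}\in(0,1),$$ $$c_k(u,v,S,B)=S(1-u)+vB(1-\lambda^s)-q_k[B(1-v)+uS(1-\lambda^b)].$$ Given $D_0>\Delta_0>0$, define recursively $$\Delta_{k+1}=\Delta_k(1-\delta_k)\,\underline y_k,\quad D_{k+1}=D_k\,\overline y_k,\quad \underline y_k=\min_{(y^s,y^b)\in\mathcal Y_k}\min(y^s,y^b),\quad \overline y_k=\max_{(y^s,y^b)\in\mathcal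 Y_k}\max(y^s,y^b),$$ and $X_k=\{(S,B): S\ge\Delta_k,\ B\ge\Delta_k,\ S+B\le D_k\}$ for $0\le k\le N$. With these choices $f_k$ maps $X_k\times\mathcal M_k\times\mathcal Y_k$ into $X_{k+1}$ and $U_k(S,B)\neq\emptyset$ for $(S,B)\in X_k$. *)

theory Defs
  imports "HOL-Probability.Probability"
begin

section \<open>Hausdorff metric and Lipschitz set-valued maps\<close>

definition eps_nbhd :: "'a::metric_space set \<Rightarrow> real \<Rightarrow> 'a set" where
  "eps_nbhd K \<epsilon> = {y. infdist y K < \<epsilon>}"

text \<open>Meaningful for non-empty compact arguments only (the library has \<open>infdist y {} = 0\<close>).\<close>

definition hausdorff_dist :: "'a::metric_space set \<Rightarrow> 'a set \<Rightarrow> real" where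
  "hausdorff_dist K1 K2 = Inf {\<epsilon>. \<epsilon> > 0 \<and> K1 \<subseteq> eps_nbhd K2 \<epsilon> \<and> K2 \<subseteq> eps_nbhd K1 \<epsilon>}"

text \<open>A Lipschitz map into the metric space of non-empty compact sets. The requirement that the
  values be non-empty and compact is part of the notion, as otherwise the Hausdorff metric is
  not defined on them.\<close>

definition hausdorff_lipschitz_on ::
  "real \<Rightarrow> 'a::metric_space set \<Rightarrow> ('a \<Rightarrow> 'b::metric_space set) \<Rightarrow> bool" where
  "hausdorff_lipschitz_on L X F \<longleftrightarrow>
     0 \<le> L \<and>
     (\<forall>x\<in>X. F x \<noteq> {} \<and> compact (F x)) \<and>
     (\<forall>x\<in>X. \<forall>x'\<in>X. hausdorff_dist (F x) (F x') \<le> L * dist x x')"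


section \<open>The asset-allocation model\<close>

text \<open>Conventions: \<open>Y\<close> is the finite value set of the random vector at one time step and
  \<open>\<Y>\<close> the family of these sets indexed by time; states \<open>(S, B)\<close>, controls \<open>(u, v)\<close> and
  values \<open>(ys, yb)\<close> of the random vector are elements of \<open>real \<times> real\<close>;
  \<open>lam_s\<close> and \<open>lam_b\<close> are the cost coefficients of transfers into the risky and the
  riskless asset, respectively.\<close>

definition transition ::
  "real \<Rightarrow> real \<Rightarrow> real \<times> real \<Rightarrow> real \<times> real \<Rightarrow> real \<times> real \<Rightarrow> real \<times> real" where
  "transition lam_s lam_b = (\<lambda>(S, B) (u, v) (ys, yb).
     ((S * (1 - u) + B * v * (1 - lam_s)) * ys, (B * (1 - v) + S * u * (1 - lam_b)) * yb))"

definition q_coeff :: "real \<Rightarrow> (real \<times> real) set \<Rightarrow> real" where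
  "q_coeff \<alpha> Y = (1 - \<alpha>) / \<alpha> * min 1 (MIN (ys, yb)\<in>Y. yb / ys)"

definition control_bound :: "real \<Rightarrow> real \<Rightarrow> (real \<times> real) set \<Rightarrow> real" where
  "control_bound \<alpha> lam_b Y = 1 / (q_coeff \<alpha> Y * (1 - lam_b) + 1)"

definition constraint ::
  "real \<Rightarrow> real \<Rightarrow> real \<Rightarrow> (real \<times> real) set \<Rightarrow> real \<times> real \<Rightarrow> real \<times> real \<Rightarrow> real" where
  "constraint \<alpha> lam_s lam_b Y = (\<lambda>(u, v) (S, B).
     S * (1 - u) + v * B * (1 - lam_s) - q_coeff \<alpha> Y * (B * (1 - v) + u * S * (1 - lam_b)))"

definition control_space :: "real \<Rightarrow> real \<Rightarrow> (real \<times> real) set \<Rightarrow> (real \<times> real) set" where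
  "control_space \<alpha> lam_b Y = {0..control_bound \<alpha> lam_b Y} \<times> {0..control_bound \<alpha> lam_b Y}"

definition admissible ::
  "real \<Rightarrow> real \<Rightarrow> real \<Rightarrow> (real \<times> real) set \<Rightarrow> real \<times> real \<Rightarrow> (real \<times> real) set" where
  "admissible \<alpha> lam_s lam_b Y x = {w \<in> control_space \<alpha> lam_b Y. constraint \<alpha> lam_s lam_b Y w x \<le> 0}"

definition y_lower :: "(real \<times> real) set \<Rightarrow> real" where
  "y_lower Y = (MIN (ys, yb)\<in>Y. min ys yb)"

definition y_upper :: "(real \<times> real) set \<Rightarrow> real" where
  "y_upper Y = (MAX (ys, yb)\<in>Y. max ys yb)"

primrec wealth_floor ::
  "real \<Rightarrow> real \<Rightarrow> (nat \<Rightarrow> (real \<times> real) set) \<Rightarrow> real \<Rightarrow> nat \<Rightarrow> real" where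
  "wealth_floor \<alpha> lam_b \<Y> \<Delta>0 0 = \<Delta>0"
| "wealth_floor \<alpha> lam_b \<Y> \<Delta>0 (Suc k) =
     wealth_floor \<alpha> lam_b \<Y> \<Delta>0 k * (1 - control_bound \<alpha> lam_b (\<Y> k)) * y_lower (\<Y> k)"

primrec wealth_cap :: "(nat \<Rightarrow> (real \<times> real) set) \<Rightarrow> real \<Rightarrow> nat \<Rightarrow> real" where
  "wealth_cap \<Y> D0 0 = D0"
| "wealth_cap \<Y> D0 (Suc k) = wealth_cap \<Y> D0 k * y_upper (\<Y> k)"

definition state_space ::
  "real \<Rightarrow> real \<Rightarrow> (nat \<Rightarrow> (real \<times> real) set) \<Rightarrow> real \<Rightarrow> real \<Rightarrow> nat \<Rightarrow> (real \<times> real) set" where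
  "state_space \<alpha> lam_b \<Y> \<Delta>0 D0 k =
     {(S, B). S \<ge> wealth_floor \<alpha> lam_b \<Y> \<Delta>0 k \<and> B \<ge> wealth_floor \<alpha> lam_b \<Y> \<Delta>0 k \<and>
              S + B \<le> wealth_cap \<Y> D0 k}"

text \<open>The backward recursion is written as a total function on \<open>real \<times> real\<close>. Its values on the
  state space at time \<open>k < N\<close> only involve values on the state space at time \<open>k + 1\<close>, because the
  transition maps the former into the latter; the values elsewhere, and those for \<open>k > N\<close>, are
  irrelevant.\<close>

function value_fun ::
  "real \<Rightarrow> real \<Rightarrow> real \<Rightarrow> (nat \<Rightarrow> (real \<times> real) set) \<Rightarrow> (nat \<Rightarrow> real \<times> real \<Rightarrow> real) \<Rightarrow>
   (real \<times> real \<Rightarrow> real) \<Rightarrow> nat \<Rightarrow> nat \<Rightarrow> real \<times> real \<Rightarrow> real" where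
  "value_fun \<alpha> lam_s lam_b \<Y> p g N k x =
     (if k < N
      then (SUP w\<in>admissible \<alpha> lam_s lam_b (\<Y> k) x.
              \<Sum>y\<in>\<Y> k. p k y * value_fun \<alpha> lam_s lam_b \<Y> p g N (Suc k) (transition lam_s lam_b x w y))
      else g x)"
  by pat_completeness auto
termination
  by (relation "Wellfounded.measure (\<lambda>(_, _, _, _, _, _, N, k, _). N - k)") auto

text \<open>As a rewrite rule the defining equation would loop.\<close>

declare value_fun.simps [simp del]

end

theory Submission
  imports Defs
begin

text \<open>The admissible controls form a sublevel set, inside a fixed square, of a function that is affine
  in the control and Lipschitz in the state. Selling the largest permitted fraction of the risky
  position and buying nothing satisfies the constraint strictly, with a slack that is uniform on
  the state space because the riskless wealth is bounded away from zero. Such a uniform Slater point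
  makes the sublevel set depend on the state in a Lipschitz way: a control that is slightly
  infeasible after a change of state is repaired by moving it a proportionally small amount towards
  the Slater point (\<open>slater_sublevel_hausdorff_lipschitz\<close>).

  For the value functions one goes backwards in time. The dynamics are polynomial, hence Lipschitz
  jointly in state and control on the bounded set of relevant pairs, and they lead from one state
  space into the next. So the expected continuation value is jointly Lipschitz whenever the next
  value function is Lipschitz, and the supremum of a jointly Lipschitz function over a Lipschitz
  family of compact sets is Lipschitz (\<open>lipschitz_on_SUP\<close>). The floors of the state spaces stay
  positive throughout, which keeps the Slater slack positive in every period and places the last
  state space in the quadrant where the terminal payoff is Lipschitz.\<close>

section \<open>The Hausdorff distance of compact sets\<close>

lemma hausdorff_dist_le:
  assumes "0 \<le> r"
    and "\<And>x. x \<in> A \<Longrightarrow> \<exists>y\<in>B. dist x y \<le> r"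
    and "\<And>y. y \<in> B \<Longrightarrow> \<exists>x\<in>A. dist y x \<le> r"
  shows "hausdorff_dist A B \<le> r"
proof (rule field_le_epsilon)
  fix e :: real
  assume "0 < e"
  have near: "P \<subseteq> eps_nbhd Q (r + e)" if "\<And>x. x \<in> P \<Longrightarrow> \<exists>y\<in>Q. dist x y \<le> r" for P Q :: "'a set"
  proof
    fix x assume "x \<in> P"
    with that obtain y where "y \<in> Q" "dist x y \<le> r" by blast
    then have "infdist x Q \<le> r" by (rule infdist_le2)
    with \<open>0 < e\<close> show "x \<in> eps_nbhd Q (r + e)" by (simp add: eps_nbhd_def)
  qed
  show "hausdorff_dist A B \<le> r + e"
    unfolding hausdorff_dist_def
  proof (rule cInf_lower)
    show "r + e \<in> {\<epsilon>. \<epsilon> > 0 \<and> A \<subseteq> eps_nbhd B \<epsilon> \<and> B \<subseteq> eps_nbhd A \<epsilon>}"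
      using near[of A B] near[of B A] assms \<open>0 < e\<close> by auto
    show "bdd_below {\<epsilon>. \<epsilon> > 0 \<and> A \<subseteq> eps_nbhd B \<epsilon> \<and> B \<subseteq> eps_nbhd A \<epsilon>}"
      by (rule bdd_belowI[of _ 0]) auto
  qed
qed

text \<open>The infimum defining the Hausdorff distance is over a non-empty set because compact sets are
  bounded, and the distance from a point to a compact set is attained.\<close>

lemma compact_hausdorff_dist_witness:
  fixes A B :: "'a::heine_borel set"
  assumes "compact A" "compact B" "B \<noteq> {}" "x \<in> A"
  obtains y where "y \<in> B" "dist x y \<le> hausdorff_dist A B"
proof -
  let ?E = "{\<epsilon>. \<epsilon> > 0 \<and> A \<subseteq> eps_nbhd B \<epsilon> \<and> B \<subseteq> eps_nbhd A \<epsilon>}"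
  have bounded: "bounded (A \<union> B)"
    using assms by (simp add: compact_imp_bounded)
  have within: "P \<subseteq> eps_nbhd Q (diameter (A \<union> B) + 1)"
    if "P \<subseteq> A \<union> B" "Q \<subseteq> A \<union> B" "Q \<noteq> {}" for P Q
  proof
    fix z assume "z \<in> P"
    from that obtain y where "y \<in> Q" by blast
    have "dist z y \<le> diameter (A \<union> B)"
      using that \<open>z \<in> P\<close> \<open>y \<in> Q\<close> by (intro diameter_bounded_bound[OF bounded]) auto
    with \<open>y \<in> Q\<close> have "infdist z Q \<le> diameter (A \<union> B)" by (rule infdist_le2)
    then show "z \<in> eps_nbhd Q (diameter (A \<union> B) + 1)" by (simp add: eps_nbhd_def)
  qed
  have "diameter (A \<union> B) + 1 \<in> ?E"
    using within[of A B] within[of B A] assms diameter_ge_0[OF bounded] by auto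
  then have "infdist x B \<le> hausdorff_dist A B"
    unfolding hausdorff_dist_def
    using \<open>x \<in> A\<close> by (intro cInf_greatest) (auto simp: eps_nbhd_def intro: less_imp_le)
  moreover obtain y where "y \<in> B" "infdist x B = dist x y"
    using infdist_attains_inf[of B x] assms compact_imp_closed by metis
  ultimately show thesis by (intro that) auto
qed

lemma hausdorff_lipschitz_on_subset:
  "hausdorff_lipschitz_on L X F \<Longrightarrow> X' \<subseteq> X \<Longrightarrow> hausdorff_lipschitz_on L X' F"
  unfolding hausdorff_lipschitz_on_def by blast

section \<open>Perturbed convex constraints\<close>

text \<open>A point feasible at \<open>x\<close> violates the constraint at \<open>x'\<close> by at most \<open>K * dist x x'\<close>. Moving it
  towards the Slater point \<open>w0\<close> by a fraction of at most that violation divided by \<open>\<eta>\<close> restores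
  feasibility by convexity, and displaces it by at most that fraction of the diameter of \<open>W\<close>.\<close>

lemma slater_sublevel_hausdorff_lipschitz:
  fixes c :: "'b::real_normed_vector \<Rightarrow> 'a::metric_space \<Rightarrow> real"
  assumes "compact W" "w0 \<in> W" "0 < \<eta>"
    and convex: "\<And>x. x \<in> X \<Longrightarrow> convex_on W (\<lambda>w. c w x)"
    and continuous: "\<And>x. x \<in> X \<Longrightarrow> continuous_on W (\<lambda>w. c w x)"
    and lipschitz: "\<And>w. w \<in> W \<Longrightarrow> K-lipschitz_on X (c w)"
    and slater: "\<And>x. x \<in> X \<Longrightarrow> c w0 x \<le> - \<eta>"
  shows "hausdorff_lipschitz_on (K / \<eta> * diameter W) X (\<lambda>x. {w \<in> W. c w x \<le> 0})"
proof -
  have "0 \<le> K"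
    using lipschitz[OF \<open>w0 \<in> W\<close>] by (rule lipschitz_on_nonneg)
  have bounded: "bounded W"
    using \<open>compact W\<close> by (rule compact_imp_bounded)
  have L: "0 \<le> K / \<eta> * diameter W"
    using \<open>0 \<le> K\<close> \<open>0 < \<eta>\<close> diameter_ge_0[OF bounded] by simp
  have repair: "\<exists>w'\<in>{w \<in> W. c w x' \<le> 0}. dist w w' \<le> K / \<eta> * diameter W * dist x x'"
    if "x \<in> X" "x' \<in> X" "w \<in> {w \<in> W. c w x \<le> 0}" for x x' w
  proof -
    define e where "e = K * dist x x'"
    \<comment> \<open>chosen so that the violation and the slack balance: \<open>(1 - t) * e = t * \<eta>\<close>\<close>
    define t where "t = e / (e + \<eta>)"
    define w' where "w' = (1 - t) *\<^sub>R w + t *\<^sub>R w0"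
    have "w \<in> W" "c w x \<le> 0" using that by auto
    have "0 \<le> e" using \<open>0 \<le> K\<close> by (simp add: e_def)
    then have t: "0 \<le> t" "t \<le> 1" "t \<le> e / \<eta>"
      using \<open>0 < \<eta>\<close> by (auto simp: t_def field_simps)
    have balance: "(1 - t) * e = t * \<eta>"
      using \<open>0 \<le> e\<close> \<open>0 < \<eta>\<close> by (simp add: t_def field_simps)
    have "w' \<in> W"
      unfolding w'_def using convex_on_imp_convex[OF convex[OF \<open>x \<in> X\<close>]] \<open>w \<in> W\<close> \<open>w0 \<in> W\<close> t
      by (intro convexD) auto
    have "dist (c w x) (c w x') \<le> e"
      unfolding e_def using lipschitz[OF \<open>w \<in> W\<close>] that by (intro lipschitz_onD)
    then have "c w x' \<le> e"
      using \<open>c w x \<le> 0\<close> by (simp add: dist_real_def)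
    have "c w' x' \<le> (1 - t) * c w x' + t * c w0 x'"
      unfolding w'_def using convex[OF \<open>x' \<in> X\<close>] t \<open>w \<in> W\<close> \<open>w0 \<in> W\<close>
      by (intro convex_onD) auto
    also have "\<dots> \<le> (1 - t) * e + t * (- \<eta>)"
      using t \<open>c w x' \<le> e\<close> slater[OF \<open>x' \<in> X\<close>] by (intro add_mono mult_left_mono) auto
    finally have "c w' x' \<le> 0"
      using balance by simp
    have "w - w' = t *\<^sub>R (w - w0)"
      by (simp add: w'_def algebra_simps)
    then have "dist w w' = t * dist w w0"
      using t by (simp add: dist_norm)
    also have "\<dots> \<le> e / \<eta> * diameter W"
      using t \<open>w \<in> W\<close> \<open>w0 \<in> W\<close>
      by (intro mult_mono diameter_bounded_bound[OF bounded]) auto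
    also have "\<dots> = K / \<eta> * diameter W * dist x x'"
      by (simp add: e_def)
    finally show ?thesis
      using \<open>w' \<in> W\<close> \<open>c w' x' \<le> 0\<close> by blast
  qed
  have "compact {w \<in> W. c w x \<le> 0}" if "x \<in> X" for x
  proof -
    have "closed {w \<in> W. c w x \<le> 0}"
      using compact_imp_closed[OF \<open>compact W\<close>] continuous[OF that]
      by (intro continuous_on_closed_Collect_le) auto
    then have "compact (W \<inter> {w \<in> W. c w x \<le> 0})"
      using \<open>compact W\<close> by (rule compact_Int_closed[rotated])
    then show ?thesis by (simp add: Int_def conj_commute cong: conj_cong)
  qed
  moreover have "{w \<in> W. c w x \<le> 0} \<noteq> {}" if "x \<in> X" for x
    using slater[OF that] \<open>w0 \<in> W\<close> \<open>0 < \<eta>\<close> by force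
  moreover have "hausdorff_dist {w \<in> W. c w x \<le> 0} {w \<in> W. c w x' \<le> 0}
      \<le> K / \<eta> * diameter W * dist x x'" if "x \<in> X" "x' \<in> X" for x x'
  proof (rule hausdorff_dist_le)
    show "0 \<le> K / \<eta> * diameter W * dist x x'"
      using L by (rule mult_nonneg_nonneg) simp
  qed (use repair[OF that] repair[OF that(2,1)] in \<open>simp_all only: dist_commute[of x' x]\<close>)
  ultimately show ?thesis
    using L unfolding hausdorff_lipschitz_on_def by blast
qed

section \<open>Suprema over Lipschitz set-valued maps\<close>

text \<open>Every choice \<open>w\<close> at \<open>x\<close> has a competitor at \<open>x'\<close> within \<open>L * dist x x'\<close>, whose payoff differs
  from that of \<open>w\<close> by at most \<open>C * (1 + L) * dist x x'\<close>.\<close>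

lemma lipschitz_on_SUP:
  fixes F :: "'a::metric_space \<Rightarrow> 'b::heine_borel set" and h :: "'a \<Rightarrow> 'b \<Rightarrow> real"
  assumes F: "hausdorff_lipschitz_on L X F"
    and h: "C-lipschitz_on (Sigma X F) (\<lambda>(x, w). h x w)"
  shows "(C * (1 + L))-lipschitz_on X (\<lambda>x. SUP w\<in>F x. h x w)"
proof -
  have L: "0 \<le> L" using F by (simp add: hausdorff_lipschitz_on_def)
  have C: "0 \<le> C" using h by (rule lipschitz_on_nonneg)
  have F_ne: "F x \<noteq> {}" and F_compact: "compact (F x)" if "x \<in> X" for x
    using F that by (auto simp: hausdorff_lipschitz_on_def)
  have bdd: "bdd_above (h x ` F x)" if "x \<in> X" for x
  proof -
    have "continuous_on (Sigma X F) (\<lambda>(x, w). h x w)"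
      using h by (rule lipschitz_on_continuous_on)
    then have "continuous_on (F x) ((\<lambda>(x, w). h x w) \<circ> Pair x)"
      using that by (intro continuous_on_compose continuous_intros)
        (auto elim!: continuous_on_subset)
    then have "continuous_on (F x) (h x)" by (simp add: o_def)
    from compact_continuous_image[OF this F_compact[OF that]] show ?thesis
      by (intro bounded_imp_bdd_above compact_imp_bounded)
  qed
  have upper: "(SUP w\<in>F x. h x w) \<le> (SUP w\<in>F x'. h x' w) + C * (1 + L) * dist x x'"
    if x: "x \<in> X" "x' \<in> X" for x x'
  proof (rule cSUP_least[OF F_ne[OF \<open>x \<in> X\<close>]])
    fix w assume w: "w \<in> F x"
    have "hausdorff_dist (F x) (F x') \<le> L * dist x x'"
      using F x by (simp add: hausdorff_lipschitz_on_def)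
    with compact_hausdorff_dist_witness[OF F_compact F_compact F_ne w] x
    obtain w' where w': "w' \<in> F x'" "dist w w' \<le> L * dist x x'"
      by (metis order_trans)
    have "dist (h x w) (h x' w') \<le> C * dist (x, w) (x', w')"
      using lipschitz_onD[OF h, of "(x, w)" "(x', w')"] x w w' by auto
    also have "dist (x, w) (x', w') \<le> dist x x' + dist w w'"
      by (simp add: dist_Pair_Pair sqrt_sum_squares_le_sum)
    also have "\<dots> \<le> (1 + L) * dist x x'"
      using w' by (simp add: algebra_simps)
    finally have "h x w \<le> h x' w' + C * (1 + L) * dist x x'"
      using C by (simp add: mult_left_mono dist_real_def mult.assoc)
    also have "h x' w' \<le> (SUP w\<in>F x'. h x' w)"
      using w' bdd[OF \<open>x' \<in> X\<close>] by (intro cSUP_upper) auto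
    finally show "h x w \<le> (SUP w\<in>F x'. h x' w) + C * (1 + L) * dist x x'" by simp
  qed
  show ?thesis
  proof (rule lipschitz_onI)
    fix x x' assume "x \<in> X" "x' \<in> X"
    then show "dist (SUP w\<in>F x. h x w) (SUP w\<in>F x'. h x' w) \<le> C * (1 + L) * dist x x'"
      using upper[of x x'] upper[of x' x] by (auto simp: dist_real_def dist_commute abs_le_iff)
  qed (use L C in simp)
qed

section \<open>Products and sums of Lipschitz functions\<close>

lemma lipschitz_on_mult_bounded:
  fixes f g :: "'a::heine_borel \<Rightarrow> real"
  assumes "bounded U" "C-lipschitz_on U f" "D-lipschitz_on U g"
  shows "\<exists>L. L-lipschitz_on U (\<lambda>x. f x * g x)"
proof -
  have "bounded (f ` U)" "bounded (g ` U)"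
    using assms by (auto intro: bounded_uniformly_continuous_image lipschitz_on_uniformly_continuous)
  then obtain P Q where P: "0 < P" "\<And>x. x \<in> U \<Longrightarrow> \<bar>f x\<bar> \<le> P"
    and Q: "0 < Q" "\<And>x. x \<in> U \<Longrightarrow> \<bar>g x\<bar> \<le> Q"
    unfolding bounded_pos by auto
  have C: "0 \<le> C" and D: "0 \<le> D"
    using assms(2,3) lipschitz_on_nonneg by blast+
  have "(P * D + C * Q)-lipschitz_on U (\<lambda>x. f x * g x)"
  proof (rule lipschitz_onI)
    fix x y assume "x \<in> U" "y \<in> U"
    have "f x * g x - f y * g y = f x * (g x - g y) + (f x - f y) * g y"
      by (simp add: algebra_simps)
    then have "dist (f x * g x) (f y * g y) \<le> \<bar>f x\<bar> * dist (g x) (g y) + dist (f x) (f y) * \<bar>g y\<bar>"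
      by (metis abs_mult abs_triangle_ineq dist_real_def)
    also have "\<dots> \<le> P * (D * dist x y) + (C * dist x y) * Q"
      using \<open>x \<in> U\<close> \<open>y \<in> U\<close> P Q C
      by (intro add_mono mult_mono lipschitz_onD[OF assms(2)] lipschitz_onD[OF assms(3)]) auto
    finally show "dist (f x * g x) (f y * g y) \<le> (P * D + C * Q) * dist x y"
      by (simp add: algebra_simps)
  qed (use P Q C D in simp)
  then show ?thesis ..
qed

lemma lipschitz_on_sum:
  fixes f :: "'i \<Rightarrow> 'a::metric_space \<Rightarrow> 'b::real_normed_vector"
  assumes "finite I" "\<And>i. i \<in> I \<Longrightarrow> \<exists>L. L-lipschitz_on U (f i)"
  shows "\<exists>L. L-lipschitz_on U (\<lambda>x. \<Sum>i\<in>I. f i x)"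
  using assms
proof (induction I)
  case empty
  show ?case using lipschitz_on_constant[of U 0] by auto
next
  case (insert i I)
  then obtain C D where "C-lipschitz_on U (f i)" "D-lipschitz_on U (\<lambda>x. \<Sum>i\<in>I. f i x)"
    by (metis insertCI)
  from lipschitz_on_add[OF this] insert show ?case by auto
qed

section \<open>A single trading period\<close>

definition wealth_region :: "real \<Rightarrow> real \<Rightarrow> (real \<times> real) set" where
  "wealth_region \<Delta> D = {(S, B). S \<ge> \<Delta> \<and> B \<ge> \<Delta> \<and> S + B \<le> D}"

lemma bounded_wealth_region: "bounded (wealth_region \<Delta> D)"
proof (rule bounded_subset)
  show "wealth_region \<Delta> D \<subseteq> {\<Delta>..D - \<Delta>} \<times> {\<Delta>..D - \<Delta>}"
    by (auto simp: wealth_region_def)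
qed (intro bounded_Times bounded_closed_interval)

locale trading_period =
  fixes \<alpha> lam_s lam_b :: real and Y :: "(real \<times> real) set"
  assumes lam_s: "0 < lam_s" "lam_s < 1"
    and lam_b: "0 < lam_b" "lam_b < 1"
    and \<alpha>: "0 < \<alpha>" "\<alpha> < 1"
    and finite_Y: "finite Y" and Y_nonempty: "Y \<noteq> {}"
    and Y_pos: "Y \<subseteq> {0<..} \<times> {0<..}"
begin

abbreviation "q \<equiv> q_coeff \<alpha> Y"

abbreviation "\<delta> \<equiv> control_bound \<alpha> lam_b Y"

lemma q_pos: "0 < q"
proof -
  have "0 < (MIN (ys, yb)\<in>Y. yb / ys)"
    using finite_Y Y_nonempty Y_pos by (subst Min_gr_iff) auto
  then show ?thesis using \<alpha> by (simp add: q_coeff_def)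
qed

lemma q_transfer_pos: "0 < q * (1 - lam_b)"
  using q_pos lam_b by simp

lemma \<delta>_pos: "0 < \<delta>" and \<delta>_less_1: "\<delta> < 1"
  using q_transfer_pos by (auto simp: control_bound_def field_simps add_pos_pos)

lemma y_lower_pos: "0 < y_lower Y"
  unfolding y_lower_def using finite_Y Y_nonempty Y_pos by (subst Min_gr_iff) auto

lemma y_lower_le:
  assumes "(ys, yb) \<in> Y"
  shows "y_lower Y \<le> ys" "y_lower Y \<le> yb"
proof -
  have "y_lower Y \<le> min ys yb"
    unfolding y_lower_def using finite_Y assms by (intro Min_le) (auto intro: rev_image_eqI)
  then show "y_lower Y \<le> ys" "y_lower Y \<le> yb" by auto
qed

lemma y_upper_ge:
  assumes "(ys, yb) \<in> Y"
  shows "ys \<le> y_upper Y" "yb \<le> y_upper Y"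
proof -
  have "max ys yb \<le> y_upper Y"
    unfolding y_upper_def using finite_Y assms by (intro Max_ge) (auto intro: rev_image_eqI)
  then show "ys \<le> y_upper Y" "yb \<le> y_upper Y" by auto
qed

text \<open>The control bound \<open>\<delta>\<close> is the fraction of the risky position whose sale makes the coefficient of
  \<open>S\<close> vanish. The constraint is affine in the controls for a fixed state and linear in the state for
  fixed controls.\<close>

lemma constraint_eq:
  "constraint \<alpha> lam_s lam_b Y (u, v) (S, B) =
     (1 - u / \<delta>) * S + (v * (1 - lam_s + q) - q) * B"
  by (simp add: constraint_def control_bound_def algebra_simps)

text \<open>Selling the fraction \<open>\<delta>\<close> and buying nothing satisfies the constraint with slack \<open>q * B\<close>, which is
  bounded below while \<open>B\<close> stays away from zero.\<close>

lemma admissible_hausdorff_lipschitz: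
  assumes "0 < \<Delta>"
  shows "\<exists>L. hausdorff_lipschitz_on L ({\<Delta>..} \<times> {\<Delta>..}) (admissible \<alpha> lam_s lam_b Y)"
proof -
  let ?c = "constraint \<alpha> lam_s lam_b Y"
  have "hausdorff_lipschitz_on ((2 + q) / (q * \<Delta>) * diameter (control_space \<alpha> lam_b Y))
      ({\<Delta>..} \<times> {\<Delta>..}) (\<lambda>x. {w \<in> control_space \<alpha> lam_b Y. ?c w x \<le> 0})"
  proof (rule slater_sublevel_hausdorff_lipschitz[where ?w0.0 = "(\<delta>, 0)"])
    show "compact (control_space \<alpha> lam_b Y)"
      by (simp add: control_space_def compact_Times)
    show "(\<delta>, 0) \<in> control_space \<alpha> lam_b Y"
      using \<delta>_pos by (simp add: control_space_def)
    show "0 < q * \<Delta>"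
      using q_pos assms by simp
  next
    fix x :: "real \<times> real"
    obtain S B where x: "x = (S, B)" by fastforce
    have affine: "?c ((1 - t) *\<^sub>R w + t *\<^sub>R w') x = (1 - t) * ?c w x + t * ?c w' x" for t w w'
      by (cases w; cases w') (simp add: x constraint_eq field_simps add_divide_distrib diff_divide_distrib)
    show "convex_on (control_space \<alpha> lam_b Y) (\<lambda>w. ?c w x)"
      by (rule convex_onI) (auto simp only: affine control_space_def intro!: convex_Times)
    show "continuous_on (control_space \<alpha> lam_b Y) (\<lambda>w. ?c w x)"
      unfolding x constraint_def case_prod_beta by (intro continuous_intros)
  next
    fix w assume "w \<in> control_space \<alpha> lam_b Y"
    then obtain u v where w: "w = (u, v)" and u: "0 \<le> u" "u \<le> \<delta>" and v: "0 \<le> v" "v \<le> \<delta>"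
      by (auto simp: control_space_def)
    have coeff_S: "\<bar>1 - u / \<delta>\<bar> \<le> 1"
      using u \<delta>_pos by (simp add: abs_le_iff field_simps)
    have "v * (1 - lam_s + q) \<le> 1 * (1 + q)"
      using v \<delta>_less_1 lam_s q_pos by (intro mult_mono) auto
    moreover have "0 \<le> v * (1 - lam_s + q)"
      using v lam_s q_pos by simp
    ultimately have coeff_B: "\<bar>v * (1 - lam_s + q) - q\<bar> \<le> 1 + q"
      using q_pos by (simp add: abs_le_iff)
    show "(2 + q)-lipschitz_on ({\<Delta>..} \<times> {\<Delta>..}) (?c w)"
    proof (rule lipschitz_onI)
      fix x x' :: "real \<times> real"
      obtain S B S' B' where x: "x = (S, B)" "x' = (S', B')" by fastforce
      have "?c w x - ?c w x' = (1 - u / \<delta>) * (S - S') + (v * (1 - lam_s + q) - q) * (B - B')"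
        by (simp add: x w constraint_eq algebra_simps diff_divide_distrib)
      then have "dist (?c w x) (?c w x')
          \<le> \<bar>1 - u / \<delta>\<bar> * dist S S' + \<bar>v * (1 - lam_s + q) - q\<bar> * dist B B'"
        by (metis abs_mult abs_triangle_ineq dist_real_def)
      also have "\<dots> \<le> 1 * dist x x' + (1 + q) * dist x x'"
        using coeff_S coeff_B q_pos dist_fst_le[of x x'] dist_snd_le[of x x']
        by (intro add_mono mult_mono) (auto simp: x)
      finally show "dist (?c w x) (?c w x') \<le> (2 + q) * dist x x'"
        by (simp add: algebra_simps)
    qed (use q_pos in simp)
  next
    fix x :: "real \<times> real" assume "x \<in> {\<Delta>..} \<times> {\<Delta>..}"
    then obtain S B where x: "x = (S, B)" "\<Delta> \<le> B" by auto
    then have "q * \<Delta> \<le> q * B" using q_pos by simp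
    then show "?c (\<delta>, 0) x \<le> - (q * \<Delta>)"
      using \<delta>_pos by (simp add: x constraint_eq)
  qed
  then show ?thesis
    unfolding admissible_def[abs_def] by blast
qed

text \<open>At least the share \<open>1 - \<delta>\<close> of each position is kept, and transfers cannot create wealth since
  the cost coefficients are positive.\<close>

lemma transition_in_wealth_region:
  assumes "0 < \<Delta>" "x \<in> wealth_region \<Delta> D" "w \<in> control_space \<alpha> lam_b Y" "y \<in> Y"
  shows "transition lam_s lam_b x w y \<in> wealth_region (\<Delta> * (1 - \<delta>) * y_lower Y) (D * y_upper Y)"
proof -
  obtain S B u v ys yb where xwy: "x = (S, B)" "w = (u, v)" "y = (ys, yb)" by (metis surj_pair)
  let ?S = "S * (1 - u) + B * v * (1 - lam_s)" and ?B = "B * (1 - v) + S * u * (1 - lam_b)"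
  have SB: "\<Delta> \<le> S" "\<Delta> \<le> B" "S + B \<le> D" and u: "0 \<le> u" "u \<le> \<delta>" and v: "0 \<le> v" "v \<le> \<delta>"
    and y: "(ys, yb) \<in> Y"
    using assms by (auto simp: xwy wealth_region_def control_space_def)
  have kept: "\<Delta> * (1 - \<delta>) \<le> S * (1 - u)" "\<Delta> * (1 - \<delta>) \<le> B * (1 - v)"
    using SB u v \<delta>_less_1 \<open>0 < \<Delta>\<close> by (auto intro!: mult_mono)
  have received: "0 \<le> B * v * (1 - lam_s)" "0 \<le> S * u * (1 - lam_b)"
    using SB u v lam_s lam_b \<open>0 < \<Delta>\<close> by auto
  have lower: "\<Delta> * (1 - \<delta>) \<le> ?S" "\<Delta> * (1 - \<delta>) \<le> ?B"
    using kept received by linarith+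
  have nonneg: "0 \<le> \<Delta> * (1 - \<delta>)"
    using \<open>0 < \<Delta>\<close> \<delta>_less_1 by simp
  have "?S + ?B = S + B - B * v * lam_s - S * u * lam_b"
    by (simp add: algebra_simps)
  also have "\<dots> \<le> D"
  proof -
    have "0 \<le> B * v * lam_s" "0 \<le> S * u * lam_b"
      using SB u v lam_s lam_b \<open>0 < \<Delta>\<close> by auto
    then show ?thesis using SB by linarith
  qed
  finally have total: "?S + ?B \<le> D" .
  have upper_pos: "0 \<le> y_upper Y"
    using y_lower_pos y_lower_le[OF y] y_upper_ge[OF y] by linarith
  have "?S * ys + ?B * yb \<le> ?S * y_upper Y + ?B * y_upper Y"
    using y_upper_ge[OF y] lower nonneg by (intro add_mono mult_left_mono) auto
  also have "\<dots> = (?S + ?B) * y_upper Y"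
    by (simp add: algebra_simps)
  also have "\<dots> \<le> D * y_upper Y"
    using total upper_pos by (rule mult_right_mono)
  finally have "?S * ys + ?B * yb \<le> D * y_upper Y" .
  moreover have "\<Delta> * (1 - \<delta>) * y_lower Y \<le> ?S * ys" "\<Delta> * (1 - \<delta>) * y_lower Y \<le> ?B * yb"
    using lower y_lower_le[OF y] nonneg y_lower_pos by (auto intro!: mult_mono)
  ultimately show ?thesis
    by (simp add: xwy transition_def wealth_region_def)
qed

text \<open>Both components are quadratic polynomials in the states and controls.\<close>

lemma transition_lipschitz:
  assumes "bounded U"
  shows "\<exists>L. L-lipschitz_on U (\<lambda>(x, w). transition lam_s lam_b x w y)"
proof -
  note coordinates = dist_fst_le dist_snd_le order_trans[OF dist_fst_le] order_trans[OF dist_snd_le]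
  have S: "1-lipschitz_on U (\<lambda>z. fst (fst z))" and B: "1-lipschitz_on U (\<lambda>z. snd (fst z))"
    and u: "1-lipschitz_on U (\<lambda>z. fst (snd z))" and v: "1-lipschitz_on U (\<lambda>z. snd (snd z))"
    for U :: "((real \<times> real) \<times> (real \<times> real)) set"
    by (auto intro!: lipschitz_onI coordinates)
  note products = lipschitz_on_mult_bounded[OF \<open>bounded U\<close>]
  obtain C1 C2 C3 C4 where
    "C1-lipschitz_on U (\<lambda>z. fst (fst z) * (1 - fst (snd z)))"
    "C2-lipschitz_on U (\<lambda>z. snd (fst z) * snd (snd z))"
    "C3-lipschitz_on U (\<lambda>z. snd (fst z) * (1 - snd (snd z)))"
    "C4-lipschitz_on U (\<lambda>z. fst (fst z) * fst (snd z))"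
    using products[OF S lipschitz_on_diff[OF lipschitz_on_constant u]] products[OF B v]
      products[OF B lipschitz_on_diff[OF lipschitz_on_constant v]] products[OF S u] by blast
  then have "\<exists>L. L-lipschitz_on U (\<lambda>z.
      (fst y * (fst (fst z) * (1 - fst (snd z)) + (1 - lam_s) * (snd (fst z) * snd (snd z))),
       snd y * (snd (fst z) * (1 - snd (snd z)) + (1 - lam_b) * (fst (fst z) * fst (snd z)))))"
    by (intro exI) (rule lipschitz_on_Pair lipschitz_on_cmult_real lipschitz_on_add | assumption)+
  then show ?thesis
    by (simp add: transition_def case_prod_beta mult_ac)
qed

text \<open>The dynamics are jointly Lipschitz in state and control only on bounded sets of pairs, which
  is where the upper bound \<open>D\<close> on total wealth enters.\<close>

lemma Bellman_step_lipschitz: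
  fixes J r :: "real \<times> real \<Rightarrow> real"
  assumes "0 < \<Delta>"
    and J: "C-lipschitz_on (wealth_region (\<Delta> * (1 - \<delta>) * y_lower Y) (D * y_upper Y)) J"
  shows "\<exists>L. L-lipschitz_on (wealth_region \<Delta> D)
    (\<lambda>x. SUP w\<in>admissible \<alpha> lam_s lam_b Y x. \<Sum>y\<in>Y. r y * J (transition lam_s lam_b x w y))"
proof -
  let ?X = "wealth_region \<Delta> D" and ?F = "admissible \<alpha> lam_s lam_b Y"
  have F_sub: "?F x \<subseteq> control_space \<alpha> lam_b Y" for x
    by (auto simp: admissible_def)
  have "bounded (control_space \<alpha> lam_b Y)"
    unfolding control_space_def by (intro bounded_Times bounded_closed_interval)
  then have "bounded (?X \<times> control_space \<alpha> lam_b Y)"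
    by (intro bounded_Times bounded_wealth_region)
  then have bounded: "bounded (Sigma ?X ?F)"
    by (rule bounded_subset) (use F_sub in blast)
  have "\<exists>L. L-lipschitz_on (Sigma ?X ?F) (\<lambda>z. r y * J (transition lam_s lam_b (fst z) (snd z) y))"
    if "y \<in> Y" for y
  proof -
    obtain L where f: "L-lipschitz_on (Sigma ?X ?F) (\<lambda>z. transition lam_s lam_b (fst z) (snd z) y)"
      using transition_lipschitz[OF bounded, of y] by (auto simp: case_prod_beta)
    have "(\<lambda>z. transition lam_s lam_b (fst z) (snd z) y) ` Sigma ?X ?F
        \<subseteq> wealth_region (\<Delta> * (1 - \<delta>) * y_lower Y) (D * y_upper Y)"
      using transition_in_wealth_region[OF \<open>0 < \<Delta>\<close> _ _ that] F_sub by fastforce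
    from lipschitz_on_cmult_real[OF lipschitz_on_compose2[OF f lipschitz_on_subset[OF J this]]]
    show ?thesis by (rule exI)
  qed
  then have "\<exists>C'. C'-lipschitz_on (Sigma ?X ?F)
      (\<lambda>z. \<Sum>y\<in>Y. r y * J (transition lam_s lam_b (fst z) (snd z) y))"
    by (rule lipschitz_on_sum[OF finite_Y])
  then obtain C' where "C'-lipschitz_on (Sigma ?X ?F)
      (\<lambda>(x, w). \<Sum>y\<in>Y. r y * J (transition lam_s lam_b x w y))"
    by (auto simp: case_prod_beta)
  moreover obtain L where "hausdorff_lipschitz_on L ?X ?F"
  proof -
    have "?X \<subseteq> {\<Delta>..} \<times> {\<Delta>..}" by (auto simp: wealth_region_def)
    with admissible_hausdorff_lipschitz[OF \<open>0 < \<Delta>\<close>] show thesis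
      using hausdorff_lipschitz_on_subset that by blast
  qed
  ultimately show ?thesis
    using lipschitz_on_SUP by blast
qed

end

section \<open>The multi-period problem\<close>

theorem proposition5p1:
  fixes M :: "'w measure"
    and N :: nat
    and Ys Yb :: "nat \<Rightarrow> 'w \<Rightarrow> real"
    and \<Y> :: "nat \<Rightarrow> (real \<times> real) set"
    and p :: "nat \<Rightarrow> real \<times> real \<Rightarrow> real"
    and \<alpha> lam_s lam_b \<Delta>0 D0 :: real
  assumes "prob_space M"
    and "0 < lam_s" "lam_s < 1" "0 < lam_b" "lam_b < 1" "0 < \<alpha>" "\<alpha> < 1"
    and "0 < \<Delta>0" "\<Delta>0 < D0"
    and "\<And>k. k < N \<Longrightarrow> finite (\<Y> k)"
    and "\<And>k. k < N \<Longrightarrow> \<Y> k \<subseteq> {0<..} \<times> {0<..}"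
    and "\<And>k. k < N \<Longrightarrow> Ys k \<in> borel_measurable M"
    and "\<And>k. k < N \<Longrightarrow> Yb k \<in> borel_measurable M"
    and "\<And>k \<omega>. k < N \<Longrightarrow> \<omega> \<in> space M \<Longrightarrow> (Ys k \<omega>, Yb k \<omega>) \<in> \<Y> k"
    and "\<And>k ys yb. k < N \<Longrightarrow> (ys, yb) \<in> \<Y> k \<Longrightarrow>
           p k (ys, yb) = measure M {\<omega> \<in> space M. Ys k \<omega> = ys \<and> Yb k \<omega> = yb}"
  shows "(\<forall>k<N. \<exists>L. hausdorff_lipschitz_on L (state_space \<alpha> lam_b \<Y> \<Delta>0 D0 k)
                         (admissible \<alpha> lam_s lam_b (\<Y> k))) \<and>
         (\<forall>g :: real \<times> real \<Rightarrow> real.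
            (\<exists>L. L-lipschitz_on ({0..} \<times> {0..}) g) \<longrightarrow>
            (\<forall>k\<le>N. \<exists>L. L-lipschitz_on (state_space \<alpha> lam_b \<Y> \<Delta>0 D0 k)
                            (value_fun \<alpha> lam_s lam_b \<Y> p g N k)))"
proof -
  have Y_nonempty: "\<Y> k \<noteq> {}" if "k < N" for k
    using prob_space.not_empty[OF assms(1)] assms(14)[OF that] by blast
  have period: "trading_period \<alpha> lam_s lam_b (\<Y> k)" if "k < N" for k
    using assms(2-7) assms(10,11)[OF that] Y_nonempty[OF that] by unfold_locales
  let ?\<Delta> = "wealth_floor \<alpha> lam_b \<Y> \<Delta>0" and ?D = "wealth_cap \<Y> D0"
  let ?X = "state_space \<alpha> lam_b \<Y> \<Delta>0 D0"
  have X: "?X k = wealth_region (?\<Delta> k) (?D k)" for k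
    by (simp add: state_space_def wealth_region_def)
  have floor_pos: "0 < ?\<Delta> k" if "k \<le> N" for k
    using that
  proof (induction k)
    case 0
    show ?case using assms(8) by simp
  next
    case (Suc k)
    interpret trading_period \<alpha> lam_s lam_b "\<Y> k" using Suc.prems by (intro period) simp
    show ?case using Suc y_lower_pos \<delta>_less_1 by simp
  qed
  have quadrant: "?X k \<subseteq> {?\<Delta> k..} \<times> {?\<Delta> k..}" for k
    by (auto simp: state_space_def)
  have "\<exists>L. hausdorff_lipschitz_on L (?X k) (admissible \<alpha> lam_s lam_b (\<Y> k))" if "k < N" for k
    using trading_period.admissible_hausdorff_lipschitz[OF period[OF that] floor_pos[of k]]
      hausdorff_lipschitz_on_subset[OF _ quadrant[of k]] that less_imp_le by blast
  moreover have "\<exists>L. L-lipschitz_on (?X k) (value_fun \<alpha> lam_s lam_b \<Y> p g N k)"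
    if g: "C-lipschitz_on ({0..} \<times> {0..}) g" and "k \<le> N" for g k C
    using \<open>k \<le> N\<close>
  proof (induction rule: inc_induct)
    case base
    have "?X N \<subseteq> {0..} \<times> {0..}"
      using quadrant[of N] floor_pos[of N] by fastforce
    with g have "C-lipschitz_on (?X N) g" by (rule lipschitz_on_subset)
    then show ?case by (auto simp: value_fun.simps[of _ _ _ _ _ _ N N])
  next
    case (step k)
    interpret trading_period \<alpha> lam_s lam_b "\<Y> k" using step by (intro period) simp
    have "value_fun \<alpha> lam_s lam_b \<Y> p g N k =
        (\<lambda>x. SUP w\<in>admissible \<alpha> lam_s lam_b (\<Y> k) x. \<Sum>y\<in>\<Y> k.
           p k y * value_fun \<alpha> lam_s lam_b \<Y> p g N (Suc k) (transition lam_s lam_b x w y))"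
      using step by (subst value_fun.simps[abs_def]) simp
    moreover have "0 < ?\<Delta> k" using step by (intro floor_pos) simp
    ultimately show ?case
      using step.IH Bellman_step_lipschitz by (auto simp: X)
  qed
  ultimately show ?thesis by blast
qed

end
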